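(* There exists a constant $C>0$ such that for all $n\ge1$ $$|F_{2n}(1,1)+G_{2n}(1,1)|\le\frac{C^{n}}{(n!)^{2}}.$$
   Context: $W,V:\mathbb{R}\to\mathbb{R}$ are strictly increasing, $W$ càdlàg, $V$ càglàd, $W(x+1)-W(x)=W(1)-W(0)$ and $V(x+1)-V(x)=V(1)-V(0)$ for all $x$, both are continuous at $0$ and $W(0)=V(0)=0$. The measures $dW,dV$ are given by $dW((a,b])=W(b)-W(a)$, $dV([a,b))=V(b)-V(a)$. For $0\le s\le x\le1$: $F_1(x,s)=W(s)$, $G_1(x,s)=V(s)$, and for $n\ge2$ $$F_{n}(x,s)=\int_{[0,s)}[F_{n-1}(x,x)-F_{n-1}(x,\xi)]\,dV(\xi)\ (n\text{ even}),\quad F_{n}(x,s)=\int_{(0,s]}[F_{n-1}(x,x)-F_{n-1}(x,\xi)]\,dW(\xi)\ (n\text{ odd}),$$ $$G_{n}(x,s)=\int_{(0,s]}[G_{n-1}(x,x)-G_{n-1}(x,\xi)]\,dW(\xi)\ (n\text{ even}),\quad G_{n}(x,s)=\int_{[0,s)}[G_{n-1}(x,x)-G_{n-1}(x,\xi)]\,dV(\xi)\ (n\text{ odd}).$$ *)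

theory Defs
  imports "HOL-Analysis.Analysis"
begin

definition cadlag :: "(real \<Rightarrow> real) \<Rightarrow> bool" where
  "cadlag f \<longleftrightarrow> (\<forall>x. continuous (at_right x) f \<and> (\<exists>l. (f \<longlongrightarrow> l) (at_left x)))"

definition caglad :: "(real \<Rightarrow> real) \<Rightarrow> bool" where
  "caglad f \<longleftrightarrow> (\<forall>x. continuous (at_left x) f \<and> (\<exists>l. (f \<longlongrightarrow> l) (at_right x)))"

text \<open>
  For increasing right-continuous \<open>W\<close>, the measure \<open>dW\<close> with \<open>dW((a,b]) = W(b) - W(a)\<close> is
  \<^const>\<open>interval_measure\<close> applied to \<open>W\<close>. For increasing left-continuous \<open>V\<close>, the measure with
  \<open>dV([a,b)) = V(b) - V(a)\<close> is obtained by reflection: \<open>x \<mapsto> -V(-x)\<close> is right-continuous, and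
  \<open>x \<mapsto> -x\<close> maps \<open>[a,b)\<close> onto \<open>(-b,-a]\<close>.
\<close>

definition left_interval_measure :: "(real \<Rightarrow> real) \<Rightarrow> real measure" where
  "left_interval_measure V = distr (interval_measure (\<lambda>x. - V (- x))) borel uminus"

lemma sets_left_interval_measure [simp, measurable_cong]:
  "sets (left_interval_measure V) = sets borel"
  by (simp add: left_interval_measure_def)

lemma emeasure_left_interval_measure_Ico:
  assumes "mono V" and cont: "\<And>x. continuous (at_left x) V" and "a \<le> b"
  shows "emeasure (left_interval_measure V) {a..<b} = ennreal (V b - V a)"
proof -
  have meas: "(uminus :: real \<Rightarrow> real) \<in> measurable (interval_measure (\<lambda>x. - V (- x))) borel"
    by simp
  have vimage: "uminus -` {a..<b} = {- b<..- a}"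
    by auto
  have right_cont: "continuous (at_right x) (\<lambda>x. - V (- x))" for x :: real
  proof -
    have "(V \<longlongrightarrow> V (- x)) (at_left (- x))"
      using cont[of "- x"] by (simp add: continuous_within)
    then have "((\<lambda>y. V (- y)) \<longlongrightarrow> V (- x)) (at_right x)"
      by (simp add: filterlim_at_left_to_right)
    then show ?thesis
      by (simp add: continuous_within tendsto_minus)
  qed
  have "emeasure (left_interval_measure V) {a..<b}
      = emeasure (interval_measure (\<lambda>x. - V (- x))) {- b<..- a}"
    using emeasure_distr[OF meas, of "{a..<b}"] by (simp add: left_interval_measure_def vimage)
  also have "\<dots> = ennreal (- V (- (- a)) - - V (- (- b)))"
    using assms right_cont by (intro emeasure_interval_measure_Ioc) (auto simp: monoD)
  finally show ?thesis
    by simp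
qed

text \<open>
  Only the values for \<open>n \<ge> 1\<close> and \<open>0 \<le> s \<le> x \<le> 1\<close> are meaningful; the value \<open>0\<close> at index \<open>0\<close> is a
  dummy which is not used by the recursion.
\<close>

fun F :: "(real \<Rightarrow> real) \<Rightarrow> (real \<Rightarrow> real) \<Rightarrow> nat \<Rightarrow> real \<Rightarrow> real \<Rightarrow> real" where
  "F W V 0 x s = 0"
| "F W V (Suc 0) x s = W s"
| "F W V (Suc (Suc n)) x s =
    (if even (Suc (Suc n))
     then LINT \<xi>:{0..<s}|left_interval_measure V. F W V (Suc n) x x - F W V (Suc n) x \<xi>
     else LINT \<xi>:{0<..s}|interval_measure W. F W V (Suc n) x x - F W V (Suc n) x \<xi>)"

fun G :: "(real \<Rightarrow> real) \<Rightarrow> (real \<Rightarrow> real) \<Rightarrow> nat \<Rightarrow> real \<Rightarrow> real \<Rightarrow> real" where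
  "G W V 0 x s = 0"
| "G W V (Suc 0) x s = V s"
| "G W V (Suc (Suc n)) x s =
    (if even (Suc (Suc n))
     then LINT \<xi>:{0<..s}|interval_measure W. G W V (Suc n) x x - G W V (Suc n) x \<xi>
     else LINT \<xi>:{0..<s}|left_interval_measure V. G W V (Suc n) x x - G W V (Suc n) x \<xi>)"

end

theory Submission
  imports Defs
begin

text \<open>
  Write \<open>r\<^sub>n(s) = F\<^sub>n(1,1) - F\<^sub>n(1,s)\<close>. The recursion says that \<open>r\<^sub>n(s)\<close> is the integral of
  \<open>r\<^sub>n\<^sub>-\<^sub>1\<close> over \<open>[s,1)\<close> against \<open>dV\<close> or over \<open>(s,1]\<close> against \<open>dW\<close>, in alternation. Unfolding it,
  \<open>F\<^sub>2\<^sub>n(1,1)\<close> is the mass, under the product of \<open>n\<close> copies of \<open>dV\<close> and \<open>n\<close> copies of \<open>dW\<close>, of the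
  set of chains \<open>0 \<le> \<xi>\<^sub>1 < \<eta>\<^sub>1 \<le> \<xi>\<^sub>2 < \<eta>\<^sub>2 \<le> \<dots> \<le> \<xi>\<^sub>n < \<eta>\<^sub>n \<le> 1\<close>.
  In such a chain the \<open>\<xi>\<^sub>i\<close> increase strictly among themselves, and so do the \<open>\<eta>\<^sub>i\<close>. Forgetting how
  the two families interlace bounds the mass by a product of two factors, each the mass of the
  strictly increasing \<open>n\<close>-tuples under a power of one finite measure. The \<open>n!\<close> permutations of
  such a tuple fill disjoint sets of equal mass, so each factor is at most (total mass)\<open>\<^sup>n / n!\<close>. The
  same holds for \<open>G\<^sub>2\<^sub>n\<close>, where the roles of the measures are exchanged.

  Strictness is essential, because \<open>dV\<close> and \<open>dW\<close> may have atoms: a point mass \<open>m\<close> gives weakly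
  increasing \<open>n\<close>-tuples the mass \<open>m\<^sup>n\<close>, without the factor \<open>1/n!\<close>.

  The masses of strict chains are nested integrals \<open>chain_mass\<close>, and \<open>chain_mass_le\<close> is the bound
  by the factorial. The lemmas \<open>closed_bound_step\<close> and \<open>open_bound_step\<close> carry the product bound
  through the recursion.
\<close>

section \<open>Masses of strictly increasing chains\<close>

primrec chain_mass :: "real measure \<Rightarrow> nat \<Rightarrow> real \<Rightarrow> ennreal" where
  "chain_mass M 0 s = 1"
| "chain_mass M (Suc n) s = (\<integral>\<^sup>+x\<in>{s<..}. chain_mass M n x \<partial>M)"

lemma chain_mass_antimono: "s \<le> t \<Longrightarrow> chain_mass M n t \<le> chain_mass M n s"
  by (cases n) (auto intro!: nn_integral_mono split: split_indicator)

lemma measurable_chain_mass [measurable]: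
  assumes "finite_measure M" and [measurable_cong]: "sets M = sets borel"
  shows "chain_mass M n \<in> borel_measurable borel"
proof (induction n)
  case (Suc n)
  interpret finite_measure M by fact
  note Suc.IH [measurable]
  have "(\<lambda>s. \<integral>\<^sup>+x. chain_mass M n x * indicator {y. s < y} x \<partial>M) \<in> borel_measurable borel"
    unfolding indicator_def by measurable
  moreover have "{y. s < y} = {s<..}" for s :: real by auto
  ultimately show ?case by simp
qed simp

text \<open>
  Add a free point \<open>y > s\<close> to a strict chain of \<open>n\<close> points above \<open>s\<close>. Each of the \<open>n + 1\<close> positions
  that \<open>y\<close> can take between the others has the mass of the strict chains of \<open>n + 1\<close> points;
  configurations in which \<open>y\<close> hits a chain point account for the inequality. The induction splits
  according to the position of \<open>y\<close> relative to the lowest chain point \<open>x\<close>. The part \<open>y < x\<close> is a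
  strict chain with one more point. In the part \<open>x < y\<close> both \<open>y\<close> and the rest of the chain lie above
  \<open>x\<close>, so that the induction hypothesis applies with \<open>x\<close> in place of \<open>s\<close>.
\<close>

lemma chain_mass_Suc_le:
  assumes fin: "finite_measure M" and sets [measurable_cong]: "sets M = sets borel"
  shows "of_nat (Suc n) * chain_mass M (Suc n) s \<le> chain_mass M 1 s * chain_mass M n s"
proof (induction n arbitrary: s)
  case (Suc n)
  interpret finite_measure M by fact
  interpret pair_sigma_finite M M ..
  note [measurable] = measurable_chain_mass[OF fin sets]
  let ?c = "chain_mass M n"
  \<comment> \<open>\<open>x\<close> is the lowest point of the chain, \<open>y\<close> the free point; the rest of the chain lies above \<open>x\<close>.\<close>
  let ?a = "\<lambda>y x. ?c x * of_bool (s < y \<and> y < x)"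
  let ?b = "\<lambda>y x. ?c x * of_bool (s < x \<and> x < y)"
  have a: "chain_mass M (Suc (Suc n)) s = (\<integral>\<^sup>+y. \<integral>\<^sup>+x. ?a y x \<partial>M \<partial>M)"
    by (auto intro!: nn_integral_cong split: split_indicator)
  have "(\<integral>\<^sup>+x\<in>{s<..}. chain_mass M 1 x * ?c x \<partial>M) = (\<integral>\<^sup>+x. \<integral>\<^sup>+y. ?b y x \<partial>M \<partial>M)"
  proof (intro nn_integral_cong)
    fix x
    have "(\<integral>\<^sup>+y. ?b y x \<partial>M) = (\<integral>\<^sup>+y. (?c x * indicator {s<..} x) * indicator {x<..} y \<partial>M)"
      by (auto intro!: nn_integral_cong split: split_indicator)
    also have "\<dots> = (?c x * indicator {s<..} x) * (\<integral>\<^sup>+y. indicator {x<..} y \<partial>M)"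
      by (rule nn_integral_cmult) simp
    finally show "chain_mass M 1 x * ?c x * indicator {s<..} x = (\<integral>\<^sup>+y. ?b y x \<partial>M)"
      by (simp add: ac_simps)
  qed
  also have "\<dots> = (\<integral>\<^sup>+y. \<integral>\<^sup>+x. ?b y x \<partial>M \<partial>M)"
    by (rule Fubini') measurable
  finally have b: "(\<integral>\<^sup>+x\<in>{s<..}. chain_mass M 1 x * ?c x \<partial>M) = (\<integral>\<^sup>+y. \<integral>\<^sup>+x. ?b y x \<partial>M \<partial>M)" .
  have "of_nat (Suc n) * chain_mass M (Suc (Suc n)) s
      = (\<integral>\<^sup>+x. of_nat (Suc n) * (chain_mass M (Suc n) x * indicator {s<..} x) \<partial>M)"
    unfolding chain_mass.simps(2)[of M "Suc n"]
    by (rule nn_integral_cmult[symmetric]) measurable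
  also have "\<dots> \<le> (\<integral>\<^sup>+x\<in>{s<..}. chain_mass M 1 x * ?c x \<partial>M)"
    using Suc.IH by (intro nn_integral_mono) (auto split: split_indicator)
  finally have IH: "of_nat (Suc n) * chain_mass M (Suc (Suc n)) s \<le> (\<integral>\<^sup>+y. \<integral>\<^sup>+x. ?b y x \<partial>M \<partial>M)"
    unfolding b .
  have "of_nat (Suc (Suc n)) * chain_mass M (Suc (Suc n)) s
      = chain_mass M (Suc (Suc n)) s + of_nat (Suc n) * chain_mass M (Suc (Suc n)) s"
    by (simp only: of_nat_Suc[of "Suc n"] distrib_right mult_1_left)
  also have "\<dots> \<le> (\<integral>\<^sup>+y. \<integral>\<^sup>+x. ?a y x \<partial>M \<partial>M) + (\<integral>\<^sup>+y. \<integral>\<^sup>+x. ?b y x \<partial>M \<partial>M)"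
    using IH by (simp only: a add_left_mono)
  also have "\<dots> = (\<integral>\<^sup>+y. (\<integral>\<^sup>+x. ?a y x \<partial>M) + (\<integral>\<^sup>+x. ?b y x \<partial>M) \<partial>M)"
    by (rule nn_integral_add[symmetric]) measurable
  also have "\<dots> = (\<integral>\<^sup>+y. \<integral>\<^sup>+x. ?a y x + ?b y x \<partial>M \<partial>M)"
    by (intro nn_integral_cong nn_integral_add[symmetric]) measurable
  also have "\<dots> \<le> (\<integral>\<^sup>+y. \<integral>\<^sup>+x. indicator {s<..} y * (?c x * indicator {s<..} x) \<partial>M \<partial>M)"
    by (intro nn_integral_mono) (auto split: split_indicator)
  also have "\<dots> = (\<integral>\<^sup>+y. indicator {s<..} y * chain_mass M (Suc n) s \<partial>M)"
    by (intro nn_integral_cong) (simp add: nn_integral_cmult)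
  also have "\<dots> = chain_mass M 1 s * chain_mass M (Suc n) s"
    by (simp add: nn_integral_multc)
  finally show ?case .
qed simp

lemma chain_mass_le:
  assumes "finite_measure M" and "sets M = sets borel"
  shows "fact n * chain_mass M n s \<le> emeasure M (space M) ^ n"
proof (induction n)
  case (Suc n)
  have one: "chain_mass M 1 s \<le> emeasure M (space M)"
    by (simp add: assms(2) emeasure_space)
  have "fact (Suc n) * chain_mass M (Suc n) s
      = fact n * (of_nat (Suc n) * chain_mass M (Suc n) s)"
    by (simp only: fact_Suc ac_simps of_nat_mult of_nat_fact)
  also have "\<dots> \<le> fact n * (chain_mass M 1 s * chain_mass M n s)"
    by (intro mult_left_mono chain_mass_Suc_le assms) simp
  also have "\<dots> = chain_mass M 1 s * (fact n * chain_mass M n s)"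
    by (simp only: ac_simps)
  also have "\<dots> \<le> emeasure M (space M) * emeasure M (space M) ^ n"
    by (intro mult_mono one Suc.IH) simp_all
  finally show ?case by simp
qed simp

section \<open>The recursion on increments\<close>

text \<open>
  Monotonicity on the unit interval is the only invariant needed to pass from Bochner integrals to
  nonnegative ones: it makes the integrand \<open>f 1 - f \<xi>\<close> measurable, nonnegative and bounded by
  \<open>f 1 - f 0\<close>, hence integrable, and the new function \<open>g\<close> is again monotone. The family \<open>A\<close> stands
  for both \<open>[0,s)\<close> and \<open>(0,s]\<close>.
\<close>

lemma
  fixes f :: "real \<Rightarrow> real" and A :: "real \<Rightarrow> real set"
  assumes f: "mono_on {0..1} f"
    and sets [measurable_cong]: "sets M = sets borel"
    and fin: "emeasure M {0..1} < \<infinity>"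
    and A [measurable]: "\<And>s. A s \<in> sets borel"
    and A_mono: "\<And>s t. s \<le> t \<Longrightarrow> A s \<subseteq> A t"
    and A_le: "A 1 \<subseteq> {0..1}"
  defines "g \<equiv> \<lambda>s. LINT \<xi>:A s|M. f 1 - f \<xi>"
  shows mono_on_iterated_integral: "mono_on {0..1} g"
    and increment_iterated_integral:
      "s \<le> 1 \<Longrightarrow> ennreal (g 1 - g s) = (\<integral>\<^sup>+\<xi>\<in>A 1 - A s. ennreal (f 1 - f \<xi>) \<partial>M)"
proof -
  let ?h = "\<lambda>\<xi>. f 1 - f \<xi>"
  have h_nonneg: "0 \<le> ?h \<xi>" and h_le: "?h \<xi> \<le> f 1 - f 0" if "\<xi> \<in> {0..1}" for \<xi>
    using that f by (auto simp: mono_on_def)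
  have "f \<in> borel_measurable (restrict_space borel {0..1})"
    using f by (rule borel_measurable_mono_on_fnc)
  then have "?h \<in> borel_measurable (restrict_space borel {0..1})"
    by measurable
  then have "(\<lambda>\<xi>. indicator {0..1} \<xi> *\<^sub>R ?h \<xi>) \<in> borel_measurable borel"
    by (subst (asm) borel_measurable_restrict_space_iff) (auto simp: ac_simps)
  then have meas: "set_borel_measurable M {0..1} ?h"
    unfolding set_borel_measurable_def by (simp add: measurable_cong_sets[OF sets refl])
  have "integrable M (indicator {0..1} :: real \<Rightarrow> real)"
    using fin by (intro integrable_real_indicator) (auto simp: sets)
  then have "integrable M (\<lambda>\<xi>. (f 1 - f 0) * indicator {0..1} \<xi>)"
    by simp
  then have "set_integrable M {0..1} ?h"
    unfolding set_integrable_def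
    by (rule Bochner_Integration.integrable_bound)
      (use meas h_nonneg h_le in \<open>auto simp: set_borel_measurable_def split: split_indicator\<close>)
  then have int: "set_integrable M B ?h" if "B \<in> sets borel" "B \<subseteq> {0..1}" for B
    using that by (auto intro: set_integrable_subset simp: sets)
  have diff: "g t - g s = (LINT \<xi>:A t - A s|M. ?h \<xi>)" if "s \<le> t" "t \<le> 1" for s t
  proof -
    have "(LINT \<xi>:A s \<union> (A t - A s)|M. ?h \<xi>)
        = (LINT \<xi>:A s|M. ?h \<xi>) + (LINT \<xi>:A t - A s|M. ?h \<xi>)"
      using A_mono[OF \<open>s \<le> t\<close>] A_mono[OF \<open>t \<le> 1\<close>] A_le
      by (intro set_integral_Un int) auto
    moreover have "A s \<union> (A t - A s) = A t"
      using A_mono[OF \<open>s \<le> t\<close>] by auto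
    ultimately show ?thesis by (simp add: g_def)
  qed
  show "mono_on {0..1} g"
  proof (rule mono_onI)
    fix s t :: real assume st: "s \<in> {0..1}" "t \<in> {0..1}" "s \<le> t"
    have "0 \<le> (LINT \<xi>:A t - A s|M. ?h \<xi>)"
      unfolding set_lebesgue_integral_def
      using st A_mono[of t 1] A_le h_nonneg
      by (intro integral_nonneg_AE AE_I2) (auto split: split_indicator)
    then show "g s \<le> g t" using diff[of s t] st by simp
  qed
  show "ennreal (g 1 - g s) = (\<integral>\<^sup>+\<xi>\<in>A 1 - A s. ennreal (?h \<xi>) \<partial>M)" if "s \<le> 1"
  proof -
    have "ennreal (g 1 - g s) = (\<integral>\<^sup>+\<xi>. ennreal (indicator (A 1 - A s) \<xi> *\<^sub>R ?h \<xi>) \<partial>M)"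
      unfolding diff[OF that order_refl] set_lebesgue_integral_def
    proof (rule nn_integral_eq_integral[symmetric])
      show "integrable M (\<lambda>\<xi>. indicator (A 1 - A s) \<xi> *\<^sub>R ?h \<xi>)"
        using int[of "A 1 - A s"] A_le by (auto simp: set_integrable_def)
      show "AE \<xi> in M. 0 \<le> indicator (A 1 - A s) \<xi> *\<^sub>R ?h \<xi>"
        using A_le h_nonneg by (intro AE_I2) (auto split: split_indicator)
    qed
    also have "\<dots> = (\<integral>\<^sup>+\<xi>\<in>A 1 - A s. ennreal (?h \<xi>) \<partial>M)"
      by (auto intro!: nn_integral_cong split: split_indicator)
    finally show ?thesis .
  qed
qed

section \<open>Alternating chains\<close>

definition unit_part :: "real measure \<Rightarrow> real measure" where
  "unit_part M = density M (indicator {0..1})"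

lemma sets_unit_part: "sets M = sets borel \<Longrightarrow> sets (unit_part M) = sets borel"
  by (simp add: unit_part_def)

lemma finite_measure_unit_part:
  assumes "sets M = sets borel" and "emeasure M {0..1} < \<infinity>"
  shows "finite_measure (unit_part M)"
  using assms sets_eq_imp_space_eq[OF assms(1)]
  by (intro finite_measureI) (simp add: unit_part_def emeasure_density)

lemma chain_mass_unit_part_Suc:
  assumes sets [measurable_cong]: "sets M = sets borel" and fin: "emeasure M {0..1} < \<infinity>"
  shows "chain_mass (unit_part M) (Suc n) s
    = (\<integral>\<^sup>+x\<in>{s<..} \<inter> {0..1}. chain_mass (unit_part M) n x \<partial>M)"
proof -
  note [measurable] =
    measurable_chain_mass[OF finite_measure_unit_part[OF sets fin] sets_unit_part[OF sets]]
  have "chain_mass (unit_part M) (Suc n) s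
      = (\<integral>\<^sup>+x. indicator {0..1} x * (chain_mass (unit_part M) n x * indicator {s<..} x) \<partial>M)"
    by (subst chain_mass.simps(2), subst (1) unit_part_def, subst nn_integral_density) simp_all
  then show ?thesis
    by (auto intro!: nn_integral_cong split: split_indicator)
qed

locale two_measures =
  fixes M N :: "real measure"
  assumes sets_M [measurable_cong]: "sets M = sets borel"
    and sets_N [measurable_cong]: "sets N = sets borel"
    and finite_M: "emeasure M {0..1} < \<infinity>"
    and finite_N: "emeasure N {0..1} < \<infinity>"
begin

abbreviation "M01 \<equiv> unit_part M"
abbreviation "N01 \<equiv> unit_part N"

lemmas sets_M01 = sets_unit_part[OF sets_M] and sets_N01 = sets_unit_part[OF sets_N]
lemmas finite_M01 = finite_measure_unit_part[OF sets_M finite_M]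
  and finite_N01 = finite_measure_unit_part[OF sets_N finite_N]
lemmas chain_mass_M01_Suc = chain_mass_unit_part_Suc[OF sets_M finite_M]
  and chain_mass_N01_Suc = chain_mass_unit_part_Suc[OF sets_N finite_N]
lemmas [measurable] =
  measurable_chain_mass[OF finite_M01 sets_M01] measurable_chain_mass[OF finite_N01 sets_N01]

text \<open>
  Here \<open>f 1 - f s\<close> stands for the mass of alternating chains with \<open>j\<close> points from \<^term>\<open>M\<close> and
  \<open>k\<close> points from \<^term>\<open>N\<close>. If the lowest point comes from \<^term>\<open>N\<close>, all points lie strictly above
  \<open>s\<close>, and \<open>open_bound\<close> holds.
\<close>

definition open_bound :: "(real \<Rightarrow> real) \<Rightarrow> nat \<Rightarrow> nat \<Rightarrow> bool" where
  "open_bound f j k \<longleftrightarrow> mono_on {0..1} f \<and>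
    (\<forall>s\<in>{0..1}. ennreal (f 1 - f s) \<le> chain_mass M01 j s * chain_mass N01 k s)"

text \<open>
  If the lowest point comes from \<^term>\<open>M\<close>, it may be \<open>s\<close> itself. Lying in \<open>[s,1)\<close>, it lies above every
  \<open>t < s\<close>; the points from \<^term>\<open>N\<close> still lie strictly above \<open>s\<close>.
\<close>

definition closed_bound :: "(real \<Rightarrow> real) \<Rightarrow> nat \<Rightarrow> nat \<Rightarrow> bool" where
  "closed_bound f j k \<longleftrightarrow> mono_on {0..1} f \<and>
    (\<forall>s\<in>{0..1}. \<forall>t<s. ennreal (f 1 - f s) \<le> chain_mass M01 j t * chain_mass N01 k s)"

text \<open>
  For \<open>\<xi>\<close> in \<open>[s,1)\<close> the factor of \<^term>\<open>N\<close> at \<open>\<xi>\<close> is at most its value at \<open>s\<close>. The rest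
  integrates over a subset of \<open>(t,1]\<close> to one more step of the chain for \<^term>\<open>M\<close>.
\<close>

lemma closed_bound_step:
  assumes "open_bound f j k"
  shows "closed_bound (\<lambda>s. LINT \<xi>:{0..<s}|M. f 1 - f \<xi>) (Suc j) k"
proof -
  have f: "mono_on {0..1} f"
    and bound: "\<And>s. s \<in> {0..1} \<Longrightarrow> ennreal (f 1 - f s) \<le> chain_mass M01 j s * chain_mass N01 k s"
    using assms by (auto simp: open_bound_def)
  let ?g = "\<lambda>s. LINT \<xi>:{0..<s}|M. f 1 - f \<xi>"
  have "ennreal (?g 1 - ?g s) \<le> chain_mass M01 (Suc j) t * chain_mass N01 k s"
    if st: "s \<in> {0..1}" "t < s" for s t
  proof -
    have "ennreal (?g 1 - ?g s) = (\<integral>\<^sup>+\<xi>\<in>{0..<1} - {0..<s}. ennreal (f 1 - f \<xi>) \<partial>M)"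
      using st by (intro increment_iterated_integral[OF f sets_M finite_M]) auto
    also have "\<dots> \<le> (\<integral>\<^sup>+\<xi>. (chain_mass M01 j \<xi> * indicator ({t<..} \<inter> {0..1}) \<xi>)
        * chain_mass N01 k s \<partial>M)"
      using st
      by (intro nn_integral_mono)
        (auto split: split_indicator intro!: order_trans[OF bound] mult_left_mono chain_mass_antimono)
    also have "\<dots> = chain_mass M01 (Suc j) t * chain_mass N01 k s"
      unfolding chain_mass_M01_Suc by (rule nn_integral_multc) measurable
    finally show ?thesis .
  qed
  moreover have "mono_on {0..1} ?g"
    by (rule mono_on_iterated_integral[OF f sets_M finite_M]) auto
  ultimately show ?thesis by (simp add: closed_bound_def)
qed

text \<open>
  The points \<open>\<xi>\<close> of \<open>(s,1]\<close> lie strictly above \<open>s\<close>, so the bound at \<open>\<xi>\<close> may be used with \<open>t = s\<close>: the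
  points from \<^term>\<open>M\<close> lie weakly above \<open>\<xi>\<close>, hence strictly above \<open>s\<close>. Thus the half-open
  intervals of the recursion keep both chains strict.
\<close>

lemma open_bound_step:
  assumes "closed_bound f j k"
  shows "open_bound (\<lambda>s. LINT \<xi>:{0<..s}|N. f 1 - f \<xi>) j (Suc k)"
proof -
  have f: "mono_on {0..1} f"
    and bound: "\<And>s t. s \<in> {0..1} \<Longrightarrow> t < s \<Longrightarrow>
      ennreal (f 1 - f s) \<le> chain_mass M01 j t * chain_mass N01 k s"
    using assms by (auto simp: closed_bound_def)
  let ?g = "\<lambda>s. LINT \<xi>:{0<..s}|N. f 1 - f \<xi>"
  have "ennreal (?g 1 - ?g s) \<le> chain_mass M01 j s * chain_mass N01 (Suc k) s"
    if s: "s \<in> {0..1}" for s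
  proof -
    have "ennreal (?g 1 - ?g s) = (\<integral>\<^sup>+\<xi>\<in>{0<..1} - {0<..s}. ennreal (f 1 - f \<xi>) \<partial>N)"
      using s by (intro increment_iterated_integral[OF f sets_N finite_N]) auto
    also have "\<dots> \<le> (\<integral>\<^sup>+\<xi>. chain_mass M01 j s
        * (chain_mass N01 k \<xi> * indicator ({s<..} \<inter> {0..1}) \<xi>) \<partial>N)"
      using s by (intro nn_integral_mono) (auto split: split_indicator intro!: bound)
    also have "\<dots> = chain_mass M01 j s * chain_mass N01 (Suc k) s"
      unfolding chain_mass_N01_Suc by (rule nn_integral_cmult) measurable
    finally show ?thesis .
  qed
  moreover have "mono_on {0..1} ?g"
    by (rule mono_on_iterated_integral[OF f sets_N finite_N]) auto
  ultimately show ?thesis by (simp add: open_bound_def)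
qed

lemma closed_bound_if_open_bound:
  assumes "open_bound f j k"
  shows "closed_bound f j k"
  unfolding closed_bound_def
proof (intro conjI ballI allI impI)
  show "mono_on {0..1} f" using assms by (simp add: open_bound_def)
  fix s t :: real assume "s \<in> {0..1}" "t < s"
  then have "ennreal (f 1 - f s) \<le> chain_mass M01 j s * chain_mass N01 k s"
    using assms by (simp add: open_bound_def)
  also have "\<dots> \<le> chain_mass M01 j t * chain_mass N01 k s"
    by (rule mult_right_mono[OF chain_mass_antimono]) (use \<open>t < s\<close> in simp_all)
  finally show "ennreal (f 1 - f s) \<le> chain_mass M01 j t * chain_mass N01 k s" .
qed

lemma closed_bound_imp_le:
  assumes f: "closed_bound f n n" and "f 0 = 0"
  shows "\<bar>f 1\<bar> \<le> (measure M01 (space M01) * measure N01 (space N01)) ^ n / (fact n)\<^sup>2"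
proof -
  interpret M01: finite_measure M01 by (rule finite_M01)
  interpret N01: finite_measure N01 by (rule finite_N01)
  let ?m = "measure M01 (space M01)" and ?n = "measure N01 (space N01)"
  have ennreal_fact: "ennreal (fact n) = fact n"
    by (metis ennreal_of_nat_eq_real_of_nat of_nat_fact)
  have "mono_on {0..1} f" using f by (simp add: closed_bound_def)
  then have "f 0 \<le> f 1" by (rule mono_onD) simp_all
  then have f1: "0 \<le> f 1" using \<open>f 0 = 0\<close> by simp
  \<comment> \<open>Any \<open>t < 0\<close> would do in place of \<open>-1\<close>: \<^term>\<open>M01\<close> is concentrated on the unit interval.\<close>
  have "ennreal (f 1 - f 0) \<le> chain_mass M01 n (-1) * chain_mass N01 n 0"
    using f by (auto simp: closed_bound_def)
  then have "ennreal (f 1) \<le> chain_mass M01 n (-1) * chain_mass N01 n 0"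
    using \<open>f 0 = 0\<close> by simp
  then have "(fact n * fact n) * ennreal (f 1)
      \<le> (fact n * fact n) * (chain_mass M01 n (-1) * chain_mass N01 n 0)"
    by (intro mult_left_mono) simp_all
  also have "\<dots> = (fact n * chain_mass M01 n (-1)) * (fact n * chain_mass N01 n 0)"
    by (simp only: ac_simps)
  also have "\<dots> \<le> emeasure M01 (space M01) ^ n * emeasure N01 (space N01) ^ n"
    by (intro mult_mono chain_mass_le finite_M01 finite_N01 sets_M01 sets_N01) simp_all
  also have "\<dots> = ennreal ((?m * ?n) ^ n)"
    by (simp add: M01.emeasure_eq_measure N01.emeasure_eq_measure ennreal_power ennreal_mult'
        power_mult_distrib)
  finally have "ennreal ((fact n)\<^sup>2 * f 1) \<le> ennreal ((?m * ?n) ^ n)"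
    using f1 by (simp add: ennreal_mult power2_eq_square ennreal_fact)
  then have "(fact n)\<^sup>2 * f 1 \<le> (?m * ?n) ^ n"
    by (subst (asm) ennreal_le_iff) simp_all
  then show ?thesis using f1 by (simp add: field_simps)
qed

end

theorem proposition18:
  fixes W V :: "real \<Rightarrow> real"
  assumes "strict_mono W" and "strict_mono V"
    and "cadlag W" and "caglad V"
    and "\<And>x. W (x + 1) - W x = W 1 - W 0"
    and "\<And>x. V (x + 1) - V x = V 1 - V 0"
    and "isCont W 0" and "isCont V 0"
    and "W 0 = 0" and "V 0 = 0"
  shows "\<exists>C::real. C > 0 \<and>
    (\<forall>n\<ge>1. \<bar>F W V (2 * n) 1 1 + G W V (2 * n) 1 1\<bar> \<le> C ^ n / (fact n)\<^sup>2)"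
proof -
  have W: "mono W" and V: "mono V"
    using assms(1,2) by (simp_all add: strict_mono_mono)
  have W_cont: "continuous (at_right x) W" for x
    using assms(3) by (simp add: cadlag_def)
  have V_cont: "continuous (at_left x) V" for x
    using assms(4) by (simp add: caglad_def)
  let ?M = "left_interval_measure V" and ?N = "interval_measure W"
  have N_Ioc: "emeasure ?N {a<..b} = ennreal (W b - W a)" if "a \<le> b" for a b
    using that W W_cont by (intro emeasure_interval_measure_Ioc) (auto simp: monoD)
  have M_Ico: "emeasure ?M {a..<b} = ennreal (V b - V a)" if "a \<le> b" for a b
    using that V V_cont by (intro emeasure_left_interval_measure_Ico) auto
  interpret two_measures ?M ?N
  proof
    have "emeasure ?M {0..1} \<le> emeasure ?M {0..<2}"
      by (intro emeasure_mono) auto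
    also have "\<dots> < \<infinity>" using M_Ico[of 0 2] by simp
    finally show "emeasure ?M {0..1} < \<infinity>" .
    have "emeasure ?N {0..1} \<le> emeasure ?N {-1<..1}"
      by (intro emeasure_mono) auto
    also have "\<dots> < \<infinity>" using N_Ioc[of "-1" 1] by simp
    finally show "emeasure ?N {0..1} < \<infinity>" .
  qed simp_all
  have W_bound: "open_bound W 0 1"
  proof -
    have "ennreal (W 1 - W s) = chain_mass N01 1 s" if "s \<in> {0..1}" for s
    proof -
      have "{s<..} \<inter> {0..1} = {s<..1}" using that by auto
      then show ?thesis
        using that N_Ioc[of s 1] chain_mass_N01_Suc[of 0 s] by simp
    qed
    then show ?thesis
      using W by (auto simp: open_bound_def mono_on_def monoD)
  qed
  have V_bound: "closed_bound V 1 0"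
  proof -
    have "ennreal (V 1 - V s) \<le> chain_mass M01 1 t" if "s \<in> {0..1}" "t < s" for s t
    proof -
      have "ennreal (V 1 - V s) = emeasure ?M {s..<1}"
        using that M_Ico[of s 1] by simp
      also have "\<dots> \<le> emeasure ?M ({t<..} \<inter> {0..1})"
        using that by (intro emeasure_mono) auto
      also have "\<dots> = chain_mass M01 1 t"
        using chain_mass_M01_Suc[of 0 t] by simp
      finally show ?thesis .
    qed
    then show ?thesis
      using V by (auto simp: closed_bound_def mono_on_def monoD)
  qed
  have F_even: "F W V (Suc (Suc (2 * n))) 1
      = (\<lambda>s. LINT \<xi>:{0..<s}|?M. F W V (Suc (2 * n)) 1 1 - F W V (Suc (2 * n)) 1 \<xi>)"
    and F_odd: "F W V (Suc (2 * Suc n)) 1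
      = (\<lambda>s. LINT \<xi>:{0<..s}|?N. F W V (Suc (Suc (2 * n))) 1 1 - F W V (Suc (Suc (2 * n))) 1 \<xi>)"
    and G_even: "G W V (Suc (Suc (2 * n))) 1
      = (\<lambda>s. LINT \<xi>:{0<..s}|?N. G W V (Suc (2 * n)) 1 1 - G W V (Suc (2 * n)) 1 \<xi>)"
    and G_odd: "G W V (Suc (2 * Suc n)) 1
      = (\<lambda>s. LINT \<xi>:{0..<s}|?M. G W V (Suc (Suc (2 * n))) 1 1 - G W V (Suc (Suc (2 * n))) 1 \<xi>)"
    for n
    by (rule ext, simp)+
  have F_odd_bound: "open_bound (F W V (Suc (2 * n)) 1) n (Suc n)" for n
  proof (induction n)
    case 0
    have "F W V (Suc 0) 1 = W" by (rule ext) simp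
    then show ?case using W_bound by simp
  next
    case (Suc n)
    show ?case
      by (rule open_bound_step[OF closed_bound_step[OF Suc.IH, folded F_even], folded F_odd])
  qed
  have F_bound: "closed_bound (F W V (Suc (Suc (2 * n))) 1) (Suc n) (Suc n)" for n
    by (rule closed_bound_step[OF F_odd_bound, folded F_even])
  have G_odd_bound: "closed_bound (G W V (Suc (2 * n)) 1) (Suc n) n" for n
  proof (induction n)
    case 0
    have "G W V (Suc 0) 1 = V" by (rule ext) simp
    then show ?case using V_bound by simp
  next
    case (Suc n)
    show ?case
      by (rule closed_bound_step[OF open_bound_step[OF Suc.IH, folded G_even], folded G_odd])
  qed
  have G_bound: "open_bound (G W V (Suc (Suc (2 * n))) 1) (Suc n) (Suc n)" for n
    by (rule open_bound_step[OF G_odd_bound, folded G_even])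
  let ?c = "measure M01 (space M01) * measure N01 (space N01)"
  \<comment> \<open>The factor 2 for the two summands is absorbed by the power since \<open>n \<ge> 1\<close>; adding 1 makes the
    constant positive without a lower bound for \<open>?c\<close>.\<close>
  have "\<bar>F W V (2 * n) 1 1 + G W V (2 * n) 1 1\<bar> \<le> (2 * ?c + 1) ^ n / (fact n)\<^sup>2" if n1: "n \<ge> 1" for n
  proof -
    obtain m where n: "n = Suc m" using n1 by (cases n) auto
    have "closed_bound (F W V (2 * n) 1) n n" "closed_bound (G W V (2 * n) 1) n n"
      using F_bound[of m] closed_bound_if_open_bound[OF G_bound[of m]]
      by (simp_all only: n mult_Suc_right add_2_eq_Suc)
    moreover have "F W V (2 * n) 1 0 = 0" "G W V (2 * n) 1 0 = 0"
      by (simp_all add: n set_lebesgue_integral_def)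
    ultimately have "\<bar>F W V (2 * n) 1 1 + G W V (2 * n) 1 1\<bar>
        \<le> ?c ^ n / (fact n)\<^sup>2 + ?c ^ n / (fact n)\<^sup>2"
      by (intro order_trans[OF abs_triangle_ineq] add_mono closed_bound_imp_le)
    also have "\<dots> = 2 * ?c ^ n / (fact n)\<^sup>2" by simp
    also have "2 * ?c ^ n \<le> (2 * ?c) ^ n"
      using n1 self_le_power[of "2::real" n]
      by (simp add: power_mult_distrib mult_right_mono)
    also have "\<dots> \<le> (2 * ?c + 1) ^ n"
      by (intro power_mono) simp_all
    finally show ?thesis by (simp add: divide_right_mono)
  qed
  moreover have "2 * ?c + 1 > 0"
    by (simp add: add_nonneg_pos)
  ultimately show ?thesis by blast
qed

end
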